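(* Let $K\subset M_N(\mathbb{C})^3\times\mathbb{C}$ be the set of $(V_0,V_1,V_2,x)$ such that $$V_{-1}V_0=V_{-1}V_1=0,\quad V_1V_0=T_2(V_2),\quad \|V_0\|_F\le\tfrac14,\quad \|V_1\|_F\le\tfrac18,\quad \|V_2\|_F\le\tfrac1{16},\quad 0<|x|\le1 .$$ Then the formal series $$V=V(V_0,V_1,V_2,x)=\sum_{k=-1}^\infty V_k(V_0,V_1,V_2)\,x^k$$ is meromorphic for $(V_0,V_1,V_2,x)\in K$.
   Context: Fix integers $N\ge 1$ and $0\le m\le N$ and put $V_{-1}=\begin{pmatrix}-2I_m&0\\0&0\end{pmatrix}\in M_N(\mathbb{C})$. For $k\ge2$, $T_k:M_N(\mathbb{C})\to M_N(\mathbb{C})$ is the linear operator $T_k(a)=k(k-1)a+V_{-1}a-k\,aV_{-1}$, invertible for $k\ge3$. $\|\cdot\|_F$ is the Frobenius norm. Given $V_0,V_1,V_2$, the matrices $V_k=V_k(V_0,V_1,V_2)$ are: the constant matrix $V_{-1}=\begin{pmatrix}-2I_m&0\\0&0\end{pmatrix}$ for $k=-1$, $V_0,V_1,V_2$ themselves for $k=0,1,2$, and $V_k=\sum_{j=1}^{k-1}j\,T_k^{-1}(V_jV_{k-1-j})$ recursively for $k\ge3$. *)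

theory Defs
  imports "HOL-Analysis.Analysis"
begin

(* The index type 'n plays the role of {1..N}, N = CARD('n) >= 1.  It is linearly ordered so that
   "the first m indices", hence the block matrix diag(-2 I_m, 0), makes sense.
   The norm of type complex^'n^'n is the Frobenius norm (the Euclidean norm of all the entries);
   the matrix product is **, since * is the entrywise product on this type. *)

type_synonym 'n mat = "complex^'n^'n"

definition cscale :: "complex \<Rightarrow> 'n::finite mat \<Rightarrow> 'n mat" where
  "cscale c A = (\<chi> i j. c * A $ i $ j)"

definition Vm1 :: "nat \<Rightarrow> 'n::{finite,linorder} mat" where
  "Vm1 m = (\<chi> i j. if i = j \<and> card {l. l < i} < m then - 2 else 0)"

definition T :: "nat \<Rightarrow> nat \<Rightarrow> 'n::{finite,linorder} mat \<Rightarrow> 'n mat" where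
  "T m k a = cscale (of_nat (k * (k - 1))) a + Vm1 m ** a - cscale (of_nat k) (a ** Vm1 m)"

(* T m k is bijective for k >= 3, the only case in which its inverse is used. *)
fun Vnat :: "nat \<Rightarrow> 'n::{finite,linorder} mat \<Rightarrow> 'n mat \<Rightarrow> 'n mat \<Rightarrow> nat \<Rightarrow> 'n mat" where
  "Vnat m V0 V1 V2 k =
     (if k = 0 then V0 else if k = 1 then V1 else if k = 2 then V2
      else \<Sum>j\<in>{1..k - 1}. cscale (of_nat j)
             (inv (T m k) (Vnat m V0 V1 V2 j ** Vnat m V0 V1 V2 (k - 1 - j))))"

declare Vnat.simps [simp del]

definition Vcoeff ::
  "nat \<Rightarrow> 'n::{finite,linorder} mat \<Rightarrow> 'n mat \<Rightarrow> 'n mat \<Rightarrow> int \<Rightarrow> 'n mat" where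
  "Vcoeff m V0 V1 V2 k = (if k = - 1 then Vm1 m else Vnat m V0 V1 V2 (nat k))"

type_synonym 'n pt = "'n mat \<times> 'n mat \<times> 'n mat \<times> complex"

abbreviation xcoord :: "'n::finite pt \<Rightarrow> complex" where
  "xcoord p \<equiv> snd (snd (snd p))"

(* The n-th term is the one of index k = n - 1, so that the summation starts at k = -1. *)
definition Vterm :: "nat \<Rightarrow> 'n::{finite,linorder} pt \<Rightarrow> nat \<Rightarrow> 'n mat" where
  "Vterm m = (\<lambda>(V0, V1, V2, x) n.
     cscale (x powi (int n - 1)) (Vcoeff m V0 V1 V2 (int n - 1)))"

(* Only meaningful where the series converges and x is nonzero. *)
definition Vsum :: "nat \<Rightarrow> 'n::{finite,linorder} pt \<Rightarrow> 'n mat" where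
  "Vsum m p = (\<Sum>n. Vterm m p n)"

definition K :: "nat \<Rightarrow> 'n::{finite,linorder} pt set" where
  "K m = {(V0, V1, V2, x).
     Vm1 m ** V0 = 0 \<and> Vm1 m ** V1 = 0 \<and> V1 ** V0 = T m 2 V2 \<and>
     norm V0 \<le> 1 / 4 \<and> norm V1 \<le> 1 / 8 \<and> norm V2 \<le> 1 / 16 \<and>
     0 < cmod x \<and> cmod x \<le> 1}"

(* Multiplication by the imaginary unit on the complex vector space 'n pt. *)
definition imult :: "'n::finite pt \<Rightarrow> 'n pt" where
  "imult = (\<lambda>(A, B, C, x). (cscale \<i> A, cscale \<i> B, cscale \<i> C, \<i> * x))"

(* Holomorphy in several variables: Frechet differentiability with a complex linear derivative
   (a real linear map is complex linear iff it commutes with multiplication by \<i>). *)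
definition holo_on :: "('n::finite pt \<Rightarrow> complex) \<Rightarrow> 'n pt set \<Rightarrow> bool" where
  "holo_on f U \<longleftrightarrow>
     (\<forall>p\<in>U. \<exists>D. (f has_derivative D) (at p) \<and> (\<forall>v. D (imult v) = \<i> * D v))"

(* Meromorphy in several variables, for an open set U: locally a quotient g / h of holomorphic
   functions, h vanishing identically on no nonempty open set.  As usual, the values of f on the
   zero set of h are disregarded. *)
definition mero_on :: "('n::finite pt \<Rightarrow> complex) \<Rightarrow> 'n pt set \<Rightarrow> bool" where
  "mero_on f U \<longleftrightarrow>
     (\<forall>p\<in>U. \<exists>W g h. open W \<and> p \<in> W \<and> W \<subseteq> U \<and> holo_on g W \<and> holo_on h W \<and>
        (\<forall>W'. open W' \<and> W' \<noteq> {} \<and> W' \<subseteq> W \<longrightarrow> (\<exists>q\<in>W'. h q \<noteq> 0)) \<and>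
        (\<forall>q\<in>W. h q \<noteq> 0 \<longrightarrow> f q = g q / h q))"

definition holo_mat_on :: "('n::finite pt \<Rightarrow> 'n mat) \<Rightarrow> 'n pt set \<Rightarrow> bool" where
  "holo_mat_on F U \<longleftrightarrow> (\<forall>i j. holo_on (\<lambda>p. F p $ i $ j) U)"

definition mero_mat_on :: "('n::finite pt \<Rightarrow> 'n mat) \<Rightarrow> 'n pt set \<Rightarrow> bool" where
  "mero_mat_on F U \<longleftrightarrow> (\<forall>i j. mero_on (\<lambda>p. F p $ i $ j) U)"

end

theory Submission
  imports Defs
begin

text \<open>
  In entries, \<open>T m k\<close> multiplies the entry \<open>(i, j)\<close> by \<open>k (k - 1) + d\<^sub>i - k d\<^sub>j\<close>, where
  \<open>d\<^sub>i \<in> {-2, 0}\<close> is the diagonal of \<open>V\<^sub>-\<^sub>1\<close>.  For \<open>k \<ge> 3\<close> this factor is at least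
  \<open>(k - 2) (k + 1) > 0\<close>, which bounds the norm of the inverse of \<open>T m k\<close>.

  A geometric bound therefore propagates through the recursion.  If \<open>\<parallel>V\<^sub>j\<parallel> \<le> c 2\<^sup>-\<^sup>j\<close> for \<open>j < k\<close>,
  then \<open>\<parallel>V\<^sub>j V\<^bsub>k-1-j\<^esub>\<parallel> \<le> c\<^sup>2 2\<^bsup>1-k\<^esup>\<close> irrespective of \<open>j\<close>, and as the weights \<open>j\<close> add up to
  \<open>k (k - 1) / 2\<close>, which is at most \<open>3/4 (k - 2) (k + 1)\<close>, one gets
  \<open>\<parallel>V\<^sub>k\<parallel> \<le> (3/2) c\<^sup>2 2\<^sup>-\<^sup>k\<close>.  Differentiating the recursion
  with respect to \<open>(V\<^sub>0, V\<^sub>1, V\<^sub>2)\<close> and using the product rule, the same computation shows that a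
  bound \<open>B 2\<^sup>-\<^sup>j\<close> for the derivatives becomes \<open>3 c B 2\<^sup>-\<^sup>k\<close>.  Both bounds are reproduced as soon as
  \<open>c \<le> 1/3\<close>, and \<open>c = 1/3\<close> still leaves room around the values \<open>1/4, 1/8, 1/16\<close> of the
  theorem, which correspond to \<open>c = 1/4\<close>.

  Consequently, on the open convex set \<open>\<parallel>V\<^sub>0\<parallel> < 1/3\<close>, \<open>\<parallel>V\<^sub>1\<parallel> < 1/6\<close>, \<open>\<parallel>V\<^sub>2\<parallel> < 1/12\<close>,
  \<open>\<bar>x\<bar> < 3/2\<close> the terms \<open>x\<^sup>k V\<^sub>k\<close> with \<open>k \<ge> 0\<close> and their derivatives are dominated by a
  multiple of \<open>(k + 1) (3/4)\<^sup>k\<close>.  The series may be differentiated term by term, and its complex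
  linear derivative shows that the sum is holomorphic, also at \<open>x = 0\<close>.  The only singular
  contribution is \<open>V\<^sub>-\<^sub>1 / x\<close>, so the whole sum is a quotient with denominator \<open>x\<close>.
\<close>

section \<open>The Frobenius norm and complex scaling\<close>

lemma norm_mat_power2:
  fixes A :: "complex^'n::finite^'k::finite"
  shows "(norm A)\<^sup>2 = (\<Sum>i\<in>UNIV. \<Sum>j\<in>UNIV. (cmod (A $ i $ j))\<^sup>2)"
  by (simp add: norm_vec_def L2_set_def sum_nonneg)

text \<open>Cauchy--Schwarz for each row of \<open>A\<close> against each column of \<open>B\<close>, summed over all pairs.\<close>

lemma norm_matrix_mult_le:
  fixes A B :: "complex^'n::finite^'n"
  shows "norm (A ** B) \<le> norm A * norm B"
proof (rule power2_le_imp_le)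
  have *: "(cmod ((A ** B) $ i $ j))\<^sup>2
      \<le> (\<Sum>k\<in>UNIV. (cmod (A $ i $ k))\<^sup>2) * (\<Sum>k\<in>UNIV. (cmod (B $ k $ j))\<^sup>2)" for i j
  proof -
    have "cmod ((A ** B) $ i $ j) \<le> (\<Sum>k\<in>UNIV. \<bar>cmod (A $ i $ k)\<bar> * \<bar>cmod (B $ k $ j)\<bar>)"
      unfolding matrix_matrix_mult_def by (simp add: sum_norm_le norm_mult)
    also have "\<dots> \<le> L2_set (\<lambda>k. cmod (A $ i $ k)) UNIV * L2_set (\<lambda>k. cmod (B $ k $ j)) UNIV"
      by (rule L2_set_mult_ineq)
    finally have "(cmod ((A ** B) $ i $ j))\<^sup>2
        \<le> (L2_set (\<lambda>k. cmod (A $ i $ k)) UNIV * L2_set (\<lambda>k. cmod (B $ k $ j)) UNIV)\<^sup>2"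
      by (rule power_mono) simp
    then show ?thesis
      by (simp add: power_mult_distrib L2_set_def sum_nonneg)
  qed
  have "(norm (A ** B))\<^sup>2 \<le> (\<Sum>i\<in>UNIV. \<Sum>j\<in>UNIV.
      (\<Sum>k\<in>UNIV. (cmod (A $ i $ k))\<^sup>2) * (\<Sum>k\<in>UNIV. (cmod (B $ k $ j))\<^sup>2))"
    unfolding norm_mat_power2 by (intro sum_mono *)
  also have "\<dots> = (\<Sum>i\<in>UNIV. \<Sum>k\<in>UNIV. (cmod (A $ i $ k))\<^sup>2)
      * (\<Sum>j\<in>UNIV. \<Sum>k\<in>UNIV. (cmod (B $ k $ j))\<^sup>2)"
    by (simp only: sum_product)
  also have "\<dots> = (norm A * norm B)\<^sup>2"
    unfolding norm_mat_power2 power_mult_distrib by (subst (2) sum.swap) simp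
  finally show "(norm (A ** B))\<^sup>2 \<le> (norm A * norm B)\<^sup>2" .
qed simp

lemma bounded_bilinear_matrix_mult:
  "bounded_bilinear ((**) :: complex^'n::finite^'n \<Rightarrow> complex^'n^'n \<Rightarrow> complex^'n^'n)"
proof
  fix a b :: "complex^'n^'n" and r :: real
  show "(r *\<^sub>R a) ** b = r *\<^sub>R (a ** b)" "a ** (r *\<^sub>R b) = r *\<^sub>R (a ** b)"
    by (simp_all add: vec_eq_iff matrix_matrix_mult_def scaleR_sum_right)
next
  show "\<exists>K. \<forall>(a :: complex^'n^'n) (b :: complex^'n^'n). norm (a ** b) \<le> norm a * norm b * K"
    by (rule exI[of _ 1]) (simp add: norm_matrix_mult_le)
qed (simp_all add: vec_eq_iff matrix_matrix_mult_def sum.distrib distrib_left distrib_right)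

lemma norm_cscale: "norm (cscale c A) = cmod c * norm A"
proof -
  have "(norm (cscale c A))\<^sup>2 = (cmod c * norm A)\<^sup>2"
    by (simp add: norm_mat_power2 cscale_def power_mult_distrib norm_mult sum_distrib_left)
  then show ?thesis
    by (simp add: power2_eq_iff_nonneg)
qed

lemma cscale_cscale: "cscale c (cscale d A) = cscale (c * d) A"
  by (simp add: vec_eq_iff cscale_def mult.assoc)

lemma cscale_add: "cscale c (A + B) = cscale c A + cscale c B"
  by (simp add: vec_eq_iff cscale_def distrib_left)

lemma cscale_sum: "cscale c (\<Sum>j\<in>J. A j) = (\<Sum>j\<in>J. cscale c (A j))"
  by (simp add: vec_eq_iff cscale_def sum_distrib_left)

lemma matrix_mult_cscale:
  "cscale c A ** B = cscale c (A ** B)" "A ** cscale c B = cscale c (A ** B)"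
  by (simp_all add: vec_eq_iff cscale_def matrix_matrix_mult_def sum_distrib_left algebra_simps)

lemma bounded_bilinear_cscale: "bounded_bilinear cscale"
proof
  show "\<exists>K. \<forall>a b. norm (cscale a b) \<le> norm a * norm b * K"
    by (rule exI[of _ 1]) (simp add: norm_cscale)
qed (simp_all add: vec_eq_iff cscale_def algebra_simps)

section \<open>The inverse of \<open>T\<close>\<close>

definition T_factor :: "nat \<Rightarrow> nat \<Rightarrow> 'n::{finite,linorder} \<Rightarrow> 'n \<Rightarrow> complex" where
  "T_factor m k i j = of_nat (k * (k - 1)) + Vm1 m $ i $ i - of_nat k * Vm1 m $ j $ j"

lemma T_entry: "T m k a $ i $ j = T_factor m k i j * a $ i $ j"
proof -
  have "(Vm1 m ** a) $ i $ j = (\<Sum>l\<in>UNIV. if l = i then Vm1 m $ i $ i * a $ i $ j else 0)"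
    "(a ** Vm1 m) $ i $ j = (\<Sum>l\<in>UNIV. if l = j then a $ i $ j * Vm1 m $ j $ j else 0)"
    unfolding matrix_matrix_mult_def vec_lambda_beta
    by (rule sum.cong; auto simp: Vm1_def)+
  then show ?thesis
    by (simp add: T_def T_factor_def cscale_def algebra_simps)
qed

text \<open>The smallest of the four possible values is attained for \<open>i\<close> in the first block and \<open>j\<close>
  in the second one: \<open>k (k - 1) - 2 = (k - 2) (k + 1)\<close>.\<close>

lemma cmod_T_factor_ge:
  assumes "k \<ge> 3"
  shows "(real k - 2) * (real k + 1) \<le> cmod (T_factor m k i j)"
proof -
  have "Re (Vm1 m $ i $ i) \<ge> - 2" "Re (Vm1 m $ j $ j) \<le> 0"
    by (simp_all add: Vm1_def)
  moreover have "real k * Re (Vm1 m $ j $ j) \<le> 0"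
    using calculation(2) by (simp add: mult_nonneg_nonpos)
  moreover have "real (k * (k - 1)) = (real k - 2) * (real k + 1) + 2"
    using assms by (simp add: algebra_simps of_nat_diff)
  ultimately have "(real k - 2) * (real k + 1) \<le> Re (T_factor m k i j)"
    unfolding T_factor_def by simp
  then show ?thesis
    using complex_Re_le_cmod order_trans by blast
qed

lemma T_factor_nonzero:
  assumes "k \<ge> 3"
  shows "T_factor m k i j \<noteq> 0"
proof -
  have "0 < (real k - 2) * (real k + 1)"
    using assms by simp
  then show ?thesis
    using cmod_T_factor_ge[OF assms, of m i j] by auto
qed

lemma inv_T_entry:
  assumes "k \<ge> 3"
  shows "inv (T m k) b $ i $ j = b $ i $ j / T_factor m k i j"
proof -
  have "inj (T m k)"
    by (rule injI) (auto simp: vec_eq_iff T_entry T_factor_nonzero[OF assms])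
  moreover have "T m k (\<chi> i j. b $ i $ j / T_factor m k i j) = b"
    by (simp add: vec_eq_iff T_entry T_factor_nonzero[OF assms])
  ultimately have "inv (T m k) b = (\<chi> i j. b $ i $ j / T_factor m k i j)"
    by (rule inv_f_eq)
  then show ?thesis
    by simp
qed

lemma norm_inv_T_le:
  assumes "k \<ge> 3"
  shows "norm (inv (T m k) b) \<le> norm b / ((real k - 2) * (real k + 1))"
proof -
  let ?c = "(real k - 2) * (real k + 1)"
  have c: "?c > 0"
    using assms by simp
  have "cmod (inv (T m k) b $ i $ j) \<le> cmod (cscale (of_real (1 / ?c)) b $ i $ j)" for i j
  proof -
    have "cmod (b $ i $ j) / cmod (T_factor m k i j) \<le> cmod (b $ i $ j) / ?c"
      by (rule frac_le[OF _ _ c cmod_T_factor_ge[OF assms]]) simp_all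
    then show ?thesis
      using c by (simp only: inv_T_entry[OF assms] cscale_def vec_lambda_beta norm_divide
        norm_mult norm_of_real) simp
  qed
  then have "norm (inv (T m k) b) \<le> norm (cscale (of_real (1 / ?c)) b)"
    by (intro norm_le_componentwise_cart)
  also have "\<dots> = norm b / ?c"
    using c by (simp only: norm_cscale norm_of_real) simp
  finally show ?thesis .
qed

lemma inv_T_cscale:
  assumes "k \<ge> 3"
  shows "inv (T m k) (cscale c b) = cscale c (inv (T m k) b)"
  by (simp add: vec_eq_iff inv_T_entry[OF assms] cscale_def)

lemma bounded_linear_inv_T:
  assumes "k \<ge> 3"
  shows "bounded_linear (inv (T m k))"
proof (rule bounded_linear_intro)
  show "norm (inv (T m k) b) \<le> norm b * (1 / ((real k - 2) * (real k + 1)))" for b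
    using norm_inv_T_le[OF assms, of m b] by simp
qed (simp_all add: vec_eq_iff inv_T_entry[OF assms] add_divide_distrib scaleR_conv_of_real)

section \<open>Geometric bounds for the coefficients\<close>

definition polydisc :: "'n::finite pt set" where
  "polydisc = ball 0 (1/3) \<times> ball 0 (1/6) \<times> ball 0 (1/12) \<times> ball 0 (3/2)"

abbreviation Vnat_at :: "nat \<Rightarrow> 'n::{finite,linorder} pt \<Rightarrow> nat \<Rightarrow> 'n mat" where
  "Vnat_at m p n \<equiv> Vnat m (fst p) (fst (snd p)) (fst (snd (snd p))) n"

lemma Vnat_initial:
  "Vnat m V0 V1 V2 0 = V0" "Vnat m V0 V1 V2 (Suc 0) = V1" "Vnat m V0 V1 V2 2 = V2"
  by (subst Vnat.simps, simp)+

lemma Vnat_rec: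
  assumes "k \<ge> 3"
  shows "Vnat m V0 V1 V2 k = (\<Sum>j\<in>{1..k - 1}. cscale (of_nat j)
    (inv (T m k) (Vnat m V0 V1 V2 j ** Vnat m V0 V1 V2 (k - 1 - j))))"
  using assms by (subst Vnat.simps) simp

text \<open>This estimate serves both the coefficients and their derivatives: the products have
  norm at most \<open>C (1/2)\<^bsup>k-1\<^esup>\<close> in both cases.  The constant comes from
  \<open>2 k (k - 1) \<le> 3 (k - 2) (k + 1)\<close>, that is, \<open>(k - 3) (k + 2) \<ge> 0\<close>.\<close>

lemma norm_rec_sum_le:
  assumes k: "k \<ge> 3" and "C \<ge> 0"
    and B: "\<And>j. j \<in> {1..k - 1} \<Longrightarrow> norm (B j) \<le> C * (1/2) ^ (k - 1)"
  shows "norm (\<Sum>j\<in>{1..k - 1}. cscale (of_nat j) (inv (T m k) (B j))) \<le> 3/2 * C * (1/2) ^ k"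
proof -
  let ?c = "(real k - 2) * (real k + 1)"
  let ?M = "C * (1/2) ^ (k - 1)"
  have c: "?c > 0"
    using k by simp
  have "norm (\<Sum>j\<in>{1..k - 1}. cscale (of_nat j) (inv (T m k) (B j)))
      \<le> (\<Sum>j\<in>{1..k - 1}. real j * (?M / ?c))"
  proof (rule sum_norm_le)
    fix j assume j: "j \<in> {1..k - 1}"
    have "norm (inv (T m k) (B j)) \<le> ?M / ?c"
      using norm_inv_T_le[OF k, of m "B j"] B[OF j] c
      by (meson divide_right_mono less_imp_le order_trans)
    then show "norm (cscale (of_nat j) (inv (T m k) (B j))) \<le> real j * (?M / ?c)"
      by (simp add: norm_cscale mult_left_mono del: times_divide_eq_right)
  qed
  also have "\<dots> = (real (k - 1) * (real (k - 1) + 1) / 2) * (?M / ?c)"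
  proof -
    have "(\<Sum>j\<in>{1..k - 1}. real j) = real (k - 1) * (real (k - 1) + 1) / 2"
      using double_gauss_sum_from_Suc_0[of "k - 1", where 'a = real] by simp
    then show ?thesis
      by (simp only: sum_distrib_right[symmetric])
  qed
  also have "\<dots> = ((real k - 1) * real k / (2 * ?c)) * ?M"
    using k by (simp add: of_nat_diff)
  also have "\<dots> \<le> 3/4 * ?M"
  proof (rule mult_right_mono)
    have "0 \<le> (real k - 3) * (real k + 2)"
      using k by simp
    then show "(real k - 1) * real k / (2 * ?c) \<le> 3/4"
      using c by (simp add: divide_le_eq) (simp add: algebra_simps)
  qed (use \<open>C \<ge> 0\<close> in simp)
  also have "\<dots> = 3/2 * C * (1/2) ^ k"
    using k by (cases k) simp_all
  finally show ?thesis .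
qed

lemma geometric_product:
  assumes "j \<le> n"
  shows "(a * (1/2) ^ j) * (b * (1/2) ^ (n - j)) = (a * b) * (1/2 :: real) ^ n"
proof -
  have "(1/2 :: real) ^ j * (1/2) ^ (n - j) = (1/2) ^ n"
    using assms by (simp flip: power_add)
  then show ?thesis
    by (simp only: mult_ac)
qed

lemma norm_Vnat_le:
  assumes "p \<in> polydisc"
  shows "norm (Vnat_at m p k) \<le> 1/3 * (1/2) ^ k"
proof (induction k rule: less_induct)
  case (less k)
  have p: "norm (fst p) < 1/3" "norm (fst (snd p)) < 1/6" "norm (fst (snd (snd p))) < 1/12"
    using assms by (auto simp: polydisc_def)
  consider "k = 0" | "k = 1" | "k = 2" | "k \<ge> 3"
    by linarith
  then show ?case
  proof cases
    assume k: "k \<ge> 3"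
    let ?V = "Vnat_at m p"
    have "norm (?V j ** ?V (k - 1 - j)) \<le> 1/9 * (1/2) ^ (k - 1)" if "j \<in> {1..k - 1}" for j
    proof -
      have "norm (?V j ** ?V (k - 1 - j)) \<le> (1/3 * (1/2) ^ j) * (1/3 * (1/2) ^ (k - 1 - j))"
        using that k by (intro order_trans[OF norm_matrix_mult_le] mult_mono less) auto
      also have "\<dots> = 1/9 * (1/2) ^ (k - 1)"
        using that by (subst geometric_product) auto
      finally show ?thesis .
    qed
    then have "norm (?V k) \<le> 3/2 * (1/9) * (1/2) ^ k"
      unfolding Vnat_rec[OF k] by (intro norm_rec_sum_le k) auto
    also have "\<dots> \<le> 1/3 * (1/2) ^ k"
      by simp
    finally show ?thesis .
  qed (use p in \<open>simp_all add: Vnat_initial power2_eq_square\<close>)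
qed

section \<open>Complex derivatives of the coefficients\<close>

definition has_complex_derivative ::
  "('n::finite pt \<Rightarrow> 'n mat) \<Rightarrow> ('n pt \<Rightarrow> 'n mat) \<Rightarrow> 'n pt \<Rightarrow> bool" where
  "has_complex_derivative F D p \<longleftrightarrow>
     (F has_derivative D) (at p) \<and> (\<forall>v. D (imult v) = cscale \<i> (D v))"

lemma has_complex_derivative_rec_sum:
  assumes k: "k \<ge> 3"
    and D: "\<And>j. j < k \<Longrightarrow> has_complex_derivative (\<lambda>q. Vnat_at m q j) (D j) p"
  shows "has_complex_derivative (\<lambda>q. Vnat_at m q k)
    (\<lambda>v. \<Sum>j\<in>{1..k - 1}. cscale (of_nat j) (inv (T m k)
       (Vnat_at m p j ** D (k - 1 - j) v + D j v ** Vnat_at m p (k - 1 - j)))) p"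
proof -
  note D' = D[unfolded has_complex_derivative_def]
  have "((\<lambda>q. Vnat_at m q k) has_derivative
    (\<lambda>v. \<Sum>j\<in>{1..k - 1}. cscale (of_nat j) (inv (T m k)
       (Vnat_at m p j ** D (k - 1 - j) v + D j v ** Vnat_at m p (k - 1 - j))))) (at p)"
    unfolding Vnat_rec[OF k]
  proof (intro has_derivative_sum
      bounded_linear.has_derivative[OF bounded_bilinear.bounded_linear_right[OF bounded_bilinear_cscale]]
      bounded_linear.has_derivative[OF bounded_linear_inv_T[OF k]]
      bounded_bilinear.FDERIV[OF bounded_bilinear_matrix_mult])
    fix j assume "j \<in> {1..k - 1}"
    then have "j < k" "k - 1 - j < k"
      using k by auto
    then show "((\<lambda>q. Vnat_at m q j) has_derivative D j) (at p)"
      "((\<lambda>q. Vnat_at m q (k - 1 - j)) has_derivative D (k - 1 - j)) (at p)"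
      using D' by blast+
  qed
  moreover have "(\<Sum>j\<in>{1..k - 1}. cscale (of_nat j) (inv (T m k)
        (Vnat_at m p j ** D (k - 1 - j) (imult v) + D j (imult v) ** Vnat_at m p (k - 1 - j))))
    = cscale \<i> (\<Sum>j\<in>{1..k - 1}. cscale (of_nat j) (inv (T m k)
        (Vnat_at m p j ** D (k - 1 - j) v + D j v ** Vnat_at m p (k - 1 - j))))" for v
    unfolding cscale_sum
  proof (intro sum.cong refl)
    fix j assume "j \<in> {1..k - 1}"
    then have "j < k" "k - 1 - j < k"
      using k by auto
    then have "D j (imult v) = cscale \<i> (D j v)"
      "D (k - 1 - j) (imult v) = cscale \<i> (D (k - 1 - j) v)"
      using D' by blast+
    then show "cscale (of_nat j) (inv (T m k)
        (Vnat_at m p j ** D (k - 1 - j) (imult v) + D j (imult v) ** Vnat_at m p (k - 1 - j)))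
      = cscale \<i> (cscale (of_nat j) (inv (T m k)
        (Vnat_at m p j ** D (k - 1 - j) v + D j v ** Vnat_at m p (k - 1 - j))))"
      by (simp only: matrix_mult_cscale cscale_add[symmetric] inv_T_cscale[OF k] cscale_cscale
          mult.commute)
  qed
  ultimately show ?thesis
    unfolding has_complex_derivative_def by blast
qed

text \<open>The constant \<open>4\<close> is what the projection \<open>V\<^sub>2\<close>, of norm \<open>1 = 4 (1/2)\<^sup>2\<close>, requires.  The
  recursion reproduces any constant: with coefficients bounded by \<open>1/3 (1/2)\<^sup>j\<close> the product rule
  gives \<open>3/2 * 2 * (1/3) = 1\<close> times the old one.\<close>

lemma Vnat_has_bounded_complex_derivative:
  assumes p: "p \<in> polydisc"
  shows "\<exists>D. has_complex_derivative (\<lambda>q. Vnat_at m q k) D p \<and>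
    (\<forall>v. norm (D v) \<le> 4 * (1/2) ^ k * norm v)"
proof (induction k rule: less_induct)
  case (less k)
  consider "k = 0" | "k = 1" | "k = 2" | "k \<ge> 3"
    by linarith
  then show ?case
  proof cases
    case 1
    have "has_complex_derivative (\<lambda>q. Vnat_at m q k) fst p"
      unfolding has_complex_derivative_def using 1
      by (auto simp: Vnat_initial imult_def intro!: derivative_eq_intros)
    moreover have "norm (fst v) \<le> 4 * (1/2) ^ k * norm v" for v :: "'a pt"
      using 1 norm_fst_le[of "fst v" "snd v"] norm_ge_zero[of v] unfolding prod.collapse
      by (auto intro: order_trans)
    ultimately show ?thesis
      by blast
  next
    case 2
    have "has_complex_derivative (\<lambda>q. Vnat_at m q k) (\<lambda>v. fst (snd v)) p"
      unfolding has_complex_derivative_def using 2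
      by (auto simp: Vnat_initial imult_def intro!: derivative_eq_intros)
    moreover have "norm (fst (snd v)) \<le> 4 * (1/2) ^ k * norm v" for v :: "'a pt"
      using 2 norm_fst_le[of "fst (snd v)" "snd (snd v)"] norm_snd_le[of "snd v" "fst v"]
        norm_ge_zero[of v] unfolding prod.collapse by (auto intro: order_trans)
    ultimately show ?thesis
      by blast
  next
    case 3
    have "has_complex_derivative (\<lambda>q. Vnat_at m q k) (\<lambda>v. fst (snd (snd v))) p"
      unfolding has_complex_derivative_def using 3
      by (auto simp: Vnat_initial imult_def intro!: derivative_eq_intros)
    moreover have "norm (fst (snd (snd v))) \<le> 4 * (1/2) ^ k * norm v" for v :: "'a pt"
      using 3 norm_fst_le[of "fst (snd (snd v))" "snd (snd (snd v))"]
        norm_snd_le[of "snd (snd v)" "fst (snd v)"] norm_snd_le[of "snd v" "fst v"]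
      unfolding prod.collapse by (auto simp: power2_eq_square)
    ultimately show ?thesis
      by blast
  next
    case k: 4
    let ?P = "\<lambda>j D. has_complex_derivative (\<lambda>q. Vnat_at m q j) D p \<and>
        (\<forall>v. norm (D v) \<le> 4 * (1/2) ^ j * norm v)"
    define D where "D j = (SOME D. ?P j D)" for j
    have "?P j (D j)" if "j < k" for j
      unfolding D_def by (rule someI_ex[OF less[OF that]])
    then have D: "\<And>j. j < k \<Longrightarrow> has_complex_derivative (\<lambda>q. Vnat_at m q j) (D j) p"
        and nD: "\<And>j v. j < k \<Longrightarrow> norm (D j v) \<le> 4 * (1/2) ^ j * norm v"
      by blast+
    let ?V = "Vnat_at m p"
    have "norm (?V j ** D (k - 1 - j) v + D j v ** ?V (k - 1 - j))
        \<le> (8/3 * norm v) * (1/2) ^ (k - 1)" if j: "j \<in> {1..k - 1}" for j v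
    proof -
      have "norm (?V j ** D (k - 1 - j) v)
          \<le> (1/3 * (1/2) ^ j) * (4 * (1/2) ^ (k - 1 - j) * norm v)"
        using j k by (intro order_trans[OF norm_matrix_mult_le] mult_mono nD norm_Vnat_le p) auto
      also have "\<dots> = (1/3 * (1/2) ^ j) * ((4 * norm v) * (1/2) ^ (k - 1 - j))"
        by simp
      also have "\<dots> = (1/3 * (4 * norm v)) * (1/2) ^ (k - 1)"
        using j by (intro geometric_product) auto
      finally have 1: "norm (?V j ** D (k - 1 - j) v) \<le> (1/3 * (4 * norm v)) * (1/2) ^ (k - 1)" .
      have "norm (D j v ** ?V (k - 1 - j))
          \<le> (4 * (1/2) ^ j * norm v) * (1/3 * (1/2) ^ (k - 1 - j))"
        using j k by (intro order_trans[OF norm_matrix_mult_le] mult_mono nD norm_Vnat_le p) auto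
      also have "\<dots> = ((4 * norm v) * (1/2) ^ j) * (1/3 * (1/2) ^ (k - 1 - j))"
        by simp
      also have "\<dots> = ((4 * norm v) * (1/3)) * (1/2) ^ (k - 1)"
        using j by (intro geometric_product) auto
      finally have 2: "norm (D j v ** ?V (k - 1 - j)) \<le> ((4 * norm v) * (1/3)) * (1/2) ^ (k - 1)" .
      show ?thesis
        by (rule order_trans[OF norm_triangle_ineq]) (use 1 2 in simp)
    qed
    then have "norm (\<Sum>j\<in>{1..k - 1}. cscale (of_nat j) (inv (T m k)
        (?V j ** D (k - 1 - j) v + D j v ** ?V (k - 1 - j))))
        \<le> 3/2 * (8/3 * norm v) * (1/2) ^ k" for v
      by (intro norm_rec_sum_le k) auto
    then have "norm (\<Sum>j\<in>{1..k - 1}. cscale (of_nat j) (inv (T m k)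
        (?V j ** D (k - 1 - j) v + D j v ** ?V (k - 1 - j))))
        \<le> 4 * (1/2) ^ k * norm v" for v
      by (simp add: mult_ac)
    with has_complex_derivative_rec_sum[OF k D] show ?thesis
      by blast
  qed
qed

section \<open>Term-by-term differentiation\<close>

text \<open>The M-test for derivatives: domination makes the series of derivatives converge uniformly
  relative to \<open>norm h\<close>, which is the hypothesis of the general theorem on differentiating series.\<close>

lemma has_derivative_suminf_dominated:
  fixes f :: "nat \<Rightarrow> 'a::real_normed_vector \<Rightarrow> 'b::banach"
  assumes S: "open S" "convex S" and x: "x \<in> S"
    and f': "\<And>n y. y \<in> S \<Longrightarrow> (f n has_derivative f' n y) (at y)"
    and b: "\<And>n y h. y \<in> S \<Longrightarrow> norm (f' n y h) \<le> b n * norm h"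
    and sb: "summable b"
    and sf: "summable (\<lambda>n. f n x)"
  shows "((\<lambda>y. \<Sum>n. f n y) has_derivative (\<lambda>h. \<Sum>n. f' n x h)) (at x)"
proof -
  have sn: "summable (\<lambda>n. norm (f' n y h))" if "y \<in> S" for y h
    by (rule summable_comparison_test'[OF summable_mult2[OF sb, of "norm h"], of 0])
      (use b[OF that] in simp)
  have unif: "\<forall>\<^sub>F n in sequentially. \<forall>y\<in>S. \<forall>h.
      norm ((\<Sum>i<n. f' i y h) - (\<Sum>i. f' i y h)) \<le> e * norm h" if "e > 0" for e
  proof -
    obtain N where N: "\<And>n. n \<ge> N \<Longrightarrow> norm (\<Sum>i. b (i + n)) < e"
      using suminf_exist_split[OF \<open>e > 0\<close> sb] by blast
    have "norm ((\<Sum>i<n. f' i y h) - (\<Sum>i. f' i y h)) \<le> e * norm h"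
      if n: "n \<ge> N" and y: "y \<in> S" for n y h
    proof -
      have s: "summable (\<lambda>i. f' i y h)"
        by (rule summable_norm_cancel[OF sn[OF y]])
      have sn': "summable (\<lambda>i. norm (f' (i + n) y h))"
        using summable_ignore_initial_segment[OF sn[OF y]] .
      have sb': "summable (\<lambda>i. b (i + n))"
        using summable_ignore_initial_segment[OF sb] .
      have "norm ((\<Sum>i<n. f' i y h) - (\<Sum>i. f' i y h)) = norm (\<Sum>i. f' (i + n) y h)"
        using suminf_split_initial_segment[OF s, of n] by simp
      also have "\<dots> \<le> (\<Sum>i. norm (f' (i + n) y h))"
        by (rule summable_norm[OF sn'])
      also have "\<dots> \<le> (\<Sum>i. b (i + n) * norm h)"
        by (rule suminf_le[OF b[OF y] sn' summable_mult2[OF sb']])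
      also have "\<dots> = (\<Sum>i. b (i + n)) * norm h"
        by (rule suminf_mult2[OF sb', symmetric])
      also have "\<dots> \<le> e * norm h"
        using N[OF n] by (intro mult_right_mono) auto
      finally show ?thesis .
    qed
    then show ?thesis
      unfolding eventually_sequentially by blast
  qed
  obtain g where g: "\<And>y. y \<in> S \<Longrightarrow> (\<lambda>n. f n y) sums g y \<and>
      (g has_derivative (\<lambda>h. \<Sum>n. f' n y h)) (at y within S)"
    using has_derivative_series[OF S(2) has_derivative_at_withinI[OF f'] unif x
      summable_sums[OF sf]] by blast
  have "(g has_derivative (\<lambda>h. \<Sum>n. f' n x h)) (at x)"
    using g[OF x] at_within_open[OF x S(1)] by simp
  then show ?thesis
    by (rule has_derivative_transform_within_open[OF _ S(1) x]) (use g sums_unique in blast)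
qed

section \<open>The regular part of the series\<close>

definition regular_term :: "nat \<Rightarrow> nat \<Rightarrow> 'n::{finite,linorder} pt \<Rightarrow> 'n mat" where
  "regular_term m n p = cscale (xcoord p ^ n) (Vnat_at m p n)"

lemma open_polydisc: "open polydisc"
  unfolding polydisc_def by (intro open_Times open_ball)

lemma convex_polydisc: "convex polydisc"
  unfolding polydisc_def by (intro convex_Times convex_ball)

lemma cmod_xcoord_power_le:
  assumes "p \<in> polydisc"
  shows "cmod (xcoord p) ^ n \<le> (3/2) ^ n"
  using assms by (intro power_mono) (auto simp: polydisc_def)

lemma power_three_halves: "(3/2 :: real) ^ n * (1/2) ^ n = (3/4) ^ n"
  by (simp flip: power_mult_distrib)

lemma summable_regular_term:
  assumes "p \<in> polydisc"
  shows "summable (\<lambda>n. regular_term m n p)"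
proof (rule summable_comparison_test'[where g = "\<lambda>n. (3/4 :: real) ^ n" and N = 0])
  fix n
  have "norm (regular_term m n p) \<le> (3/2) ^ n * (1/3 * (1/2) ^ n)"
    unfolding regular_term_def norm_cscale norm_power
    by (intro mult_mono cmod_xcoord_power_le norm_Vnat_le assms) auto
  also have "\<dots> = 1/3 * (3/4) ^ n"
    by (simp add: power_three_halves[symmetric])
  also have "\<dots> \<le> (3/4) ^ n"
    by simp
  finally show "norm (regular_term m n p) \<le> (3/4) ^ n" .
qed simp

lemma regular_term_has_bounded_complex_derivative:
  assumes p: "p \<in> polydisc"
  shows "\<exists>D. has_complex_derivative (regular_term m n) D p \<and>
    (\<forall>v. norm (D v) \<le> 4 * (real (Suc n) * (3/4) ^ n) * norm v)"
proof -
  obtain D where D: "has_complex_derivative (\<lambda>q. Vnat_at m q n) D p"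
    and nD: "\<And>v. norm (D v) \<le> 4 * (1/2) ^ n * norm v"
    using Vnat_has_bounded_complex_derivative[OF p] by blast
  define E where "E v = cscale (xcoord p ^ n) (D v)
    + cscale (of_nat n * xcoord v * xcoord p ^ (n - 1)) (Vnat_at m p n)" for v
  have dx: "((\<lambda>q. xcoord q ^ n) has_derivative
      (\<lambda>v. of_nat n * xcoord v * xcoord p ^ (n - 1))) (at p)"
    by (auto intro!: derivative_eq_intros)
  have "(regular_term m n has_derivative E) (at p)"
    using bounded_bilinear.FDERIV[OF bounded_bilinear_cscale dx
        D[unfolded has_complex_derivative_def, THEN conjunct1]]
    unfolding regular_term_def[abs_def] E_def[abs_def] .
  moreover have "E (imult v) = cscale \<i> (E v)" for v
  proof -
    have "D (imult v) = cscale \<i> (D v)" "xcoord (imult v) = \<i> * xcoord v"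
      using D by (auto simp: has_complex_derivative_def imult_def split: prod.split)
    then show ?thesis
      by (simp add: E_def cscale_add cscale_cscale mult_ac)
  qed
  moreover have "norm (E v) \<le> 4 * (real (Suc n) * (3/4) ^ n) * norm v" for v
  proof -
    have "norm (cscale (xcoord p ^ n) (D v)) \<le> (3/2) ^ n * (4 * (1/2) ^ n * norm v)"
      unfolding norm_cscale norm_power
      by (intro mult_mono cmod_xcoord_power_le nD p) auto
    also have "\<dots> = 4 * (3/4) ^ n * norm v"
      by (simp add: power_three_halves[symmetric])
    finally have 1: "norm (cscale (xcoord p ^ n) (D v)) \<le> 4 * (3/4) ^ n * norm v" .
    have v: "cmod (xcoord v) \<le> norm v"
      using norm_snd_le[of "snd (snd v)" "fst (snd v)"] norm_snd_le[of "snd v" "fst v"]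
        norm_snd_le[of "snd (snd (snd v))" "fst (snd (snd v))"]
      unfolding prod.collapse by linarith
    have "cmod (xcoord p) ^ (n - 1) \<le> (3/2) ^ n"
      by (rule order_trans[OF cmod_xcoord_power_le[OF p] power_increasing]) auto
    then have "norm (cscale (of_nat n * xcoord v * xcoord p ^ (n - 1)) (Vnat_at m p n))
        \<le> (real n * norm v * (3/2) ^ n) * (1/3 * (1/2) ^ n)"
      unfolding norm_cscale norm_power norm_mult norm_of_nat
      by (intro mult_mono v order.refl norm_Vnat_le p) auto
    also have "\<dots> = 1/3 * (real n * (3/4) ^ n * norm v)"
      by (simp add: power_three_halves[symmetric])
    also have "\<dots> \<le> 4 * (real n * (3/4) ^ n * norm v)"
      by (rule mult_right_mono) auto
    finally have "norm (E v) \<le> 4 * (3/4) ^ n * norm v + 4 * (real n * (3/4) ^ n * norm v)"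
      unfolding E_def using 1 norm_triangle_mono by blast
    then show ?thesis
      by (simp add: algebra_simps)
  qed
  ultimately show ?thesis
    unfolding has_complex_derivative_def by blast
qed

lemma regular_part_has_complex_derivative:
  assumes p: "p \<in> polydisc"
  shows "\<exists>D. has_complex_derivative (\<lambda>q. \<Sum>n. regular_term m n q) D p"
proof -
  let ?P = "\<lambda>n q D. has_complex_derivative (regular_term m n) D q \<and>
      (\<forall>v. norm (D v) \<le> 4 * (real (Suc n) * (3/4) ^ n) * norm v)"
  define D where "D n q = (SOME D. ?P n q D)" for n and q :: "'a pt"
  have "?P n q (D n q)" if "q \<in> polydisc" for n q
    unfolding D_def by (rule someI_ex[OF regular_term_has_bounded_complex_derivative[OF that]])
  then have D: "\<And>n q. q \<in> polydisc \<Longrightarrow> has_complex_derivative (regular_term m n) (D n q) q"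
    and nD: "\<And>n q v. q \<in> polydisc \<Longrightarrow>
      norm (D n q v) \<le> 4 * (real (Suc n) * (3/4) ^ n) * norm v"
    by blast+
  have sb: "summable (\<lambda>n. 4 * (real (Suc n) * (3/4) ^ n))"
    using geometric_deriv_sums[of "3/4 :: real"] by (intro summable_mult) (auto simp: sums_iff)
  have sD: "summable (\<lambda>n. D n p v)" for v
    by (rule summable_comparison_test'[OF summable_mult2[OF sb, of "norm v"], of 0])
      (use nD[OF p] in simp)
  have "((\<lambda>q. \<Sum>n. regular_term m n q) has_derivative (\<lambda>v. \<Sum>n. D n p v)) (at p)"
  proof (rule has_derivative_suminf_dominated[OF open_polydisc convex_polydisc p])
    show "(regular_term m n has_derivative D n q) (at q)" if "q \<in> polydisc" for n q
      using D[OF that] unfolding has_complex_derivative_def by blast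
    show "norm (D n q v) \<le> 4 * (real (Suc n) * (3/4) ^ n) * norm v"
      if "q \<in> polydisc" for n q v
      using nD[OF that] .
  qed (rule sb summable_regular_term[OF p])+
  moreover have "(\<Sum>n. D n p (imult v)) = cscale \<i> (\<Sum>n. D n p v)" for v
  proof -
    have "D n p (imult v) = cscale \<i> (D n p v)" for n
      using D[OF p, of n] unfolding has_complex_derivative_def by blast
    then show ?thesis
      by (simp only: bounded_linear.suminf[OF
            bounded_bilinear.bounded_linear_right[OF bounded_bilinear_cscale] sD])
  qed
  ultimately show ?thesis
    unfolding has_complex_derivative_def by blast
qed

lemma holo_on_regular_part:
  "holo_on (\<lambda>p. (\<Sum>n. regular_term m n p) $ i $ j) polydisc"
  unfolding holo_on_def
proof
  fix p :: "'a pt" assume "p \<in> polydisc"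
  then obtain D where D: "((\<lambda>q. \<Sum>n. regular_term m n q) has_derivative D) (at p)"
      "\<And>v. D (imult v) = cscale \<i> (D v)"
    using regular_part_has_complex_derivative unfolding has_complex_derivative_def by blast
  have "bounded_linear (\<lambda>A :: 'a mat. A $ i $ j)"
    using bounded_linear_compose[OF bounded_linear_vec_nth bounded_linear_vec_nth] .
  then have "((\<lambda>q. (\<Sum>n. regular_term m n q) $ i $ j) has_derivative (\<lambda>v. D v $ i $ j)) (at p)"
    by (rule bounded_linear.has_derivative[OF _ D(1)])
  moreover have "D (imult v) $ i $ j = \<i> * (D v $ i $ j)" for v
    by (simp add: D(2) cscale_def)
  ultimately show "\<exists>D. ((\<lambda>p. (\<Sum>n. regular_term m n p) $ i $ j) has_derivative D) (at p) \<and>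
      (\<forall>v. D (imult v) = \<i> * D v)"
    by blast
qed

section \<open>Rules for holomorphic functions\<close>

lemma holo_on_subset: "holo_on f U \<Longrightarrow> W \<subseteq> U \<Longrightarrow> holo_on f W"
  unfolding holo_on_def by blast

lemma holo_on_const: "holo_on (\<lambda>p. c) U"
  unfolding holo_on_def by (intro ballI exI[of _ "\<lambda>v. 0"]) simp

lemma holo_on_xcoord: "holo_on xcoord U"
  unfolding holo_on_def
  by (intro ballI exI[of _ xcoord])
    (auto simp: imult_def split: prod.split intro!: derivative_eq_intros)

lemma holo_on_add:
  assumes "holo_on f U" "holo_on g U"
  shows "holo_on (\<lambda>p. f p + g p) U"
  unfolding holo_on_def
proof
  fix p assume "p \<in> U"
  then obtain D E where "(f has_derivative D) (at p)" "(g has_derivative E) (at p)"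
      "\<And>v. D (imult v) = \<i> * D v" "\<And>v. E (imult v) = \<i> * E v"
    using assms unfolding holo_on_def by metis
  then show "\<exists>D. ((\<lambda>p. f p + g p) has_derivative D) (at p) \<and> (\<forall>v. D (imult v) = \<i> * D v)"
    by (intro exI[of _ "\<lambda>v. D v + E v"]) (auto simp: algebra_simps intro: has_derivative_add)
qed

lemma holo_on_mult:
  assumes "holo_on f U" "holo_on g U"
  shows "holo_on (\<lambda>p. f p * g p) U"
  unfolding holo_on_def
proof
  fix p assume "p \<in> U"
  then obtain D E where "(f has_derivative D) (at p)" "(g has_derivative E) (at p)"
      "\<And>v. D (imult v) = \<i> * D v" "\<And>v. E (imult v) = \<i> * E v"
    using assms unfolding holo_on_def by metis
  then show "\<exists>D. ((\<lambda>p. f p * g p) has_derivative D) (at p) \<and> (\<forall>v. D (imult v) = \<i> * D v)"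
    by (intro exI[of _ "\<lambda>v. f p * E v + D v * g p"] conjI has_derivative_mult)
      (simp_all add: algebra_simps)
qed

lemma holo_on_inverse:
  assumes "holo_on f U" "\<And>p. p \<in> U \<Longrightarrow> f p \<noteq> 0"
  shows "holo_on (\<lambda>p. inverse (f p)) U"
  unfolding holo_on_def
proof
  fix p assume p: "p \<in> U"
  then obtain D where "(f has_derivative D) (at p)" "\<And>v. D (imult v) = \<i> * D v"
    using assms unfolding holo_on_def by metis
  then show "\<exists>D. ((\<lambda>p. inverse (f p)) has_derivative D) (at p) \<and> (\<forall>v. D (imult v) = \<i> * D v)"
    using assms(2)[OF p]
    by (intro exI[of _ "\<lambda>v. - (inverse (f p) * D v * inverse (f p))"] conjI
        Deriv.has_derivative_inverse) simp_all
qed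

lemma holo_on_cong:
  assumes "open U" "\<And>p. p \<in> U \<Longrightarrow> f p = g p" "holo_on g U"
  shows "holo_on f U"
  using assms(3) has_derivative_transform_within_open[OF _ assms(1), of g _ _ UNIV f] assms(2)
  unfolding holo_on_def by (metis (no_types, lifting))

section \<open>Meromorphy of the full series\<close>

lemma Vterm_Suc: "Vterm m p (Suc n) = regular_term m n p"
  by (cases p) (simp add: Vterm_def regular_term_def Vcoeff_def)

lemma Vterm_0: "Vterm m p 0 = cscale (inverse (xcoord p)) (Vm1 m)"
  by (cases p) (simp add: Vterm_def Vcoeff_def)

lemma summable_Vterm: "p \<in> polydisc \<Longrightarrow> summable (Vterm m p)"
  using summable_regular_term[of p m] summable_Suc_iff[of "Vterm m p"] by (simp add: Vterm_Suc)

lemma Vsum_decomp: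
  assumes "p \<in> polydisc"
  shows "Vsum m p = cscale (inverse (xcoord p)) (Vm1 m) + (\<Sum>n. regular_term m n p)"
  using suminf_split_head[OF summable_Vterm[OF assms], of m]
  by (simp add: Vsum_def Vterm_Suc Vterm_0)

lemma open_xcoord_nonzero: "open {p :: 'n::finite pt. xcoord p \<noteq> 0}"
  by (intro open_Collect_neq continuous_intros)

text \<open>The denominator \<open>x\<close> of the quotient is admissible: an open set on which \<open>x\<close> vanished would
  have a slice in the last coordinate that is open and equal to \<open>{0}\<close>.\<close>

lemma xcoord_nonzero_in_open:
  fixes W :: "'n::finite pt set"
  assumes "open W" "W \<noteq> {}"
  shows "\<exists>q\<in>W. xcoord q \<noteq> 0"
proof (rule ccontr)
  assume *: "\<not> ?thesis"
  obtain A B C x where p: "(A, B, C, x) \<in> W"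
    using assms(2) by (metis ex_in_conv prod.collapse)
  have "open ((\<lambda>t. (A, B, C, t)) -` W)"
    by (intro open_vimage assms continuous_intros)
  moreover have "(\<lambda>t. (A, B, C, t)) -` W = {x}"
  proof -
    have zero: "t = 0" if "(A, B, C, t) \<in> W" for t
      using * that by force
    show ?thesis
      using p zero[OF p] by (auto dest: zero)
  qed
  ultimately show False
    using not_open_singleton by metis
qed

lemma closure_K_subset: "closure (K m) \<subseteq> polydisc"
proof -
  have "closure (K m) \<subseteq> cball 0 (1/4) \<times> cball 0 (1/8) \<times> cball 0 (1/16) \<times> cball 0 1"
    by (intro closure_minimal closed_Times closed_cball) (auto simp: K_def)
  also have "\<dots> \<subseteq> polydisc"
    by (auto simp: polydisc_def)
  finally show ?thesis .
qed

lemma holo_mat_on_Vsum: "holo_mat_on (Vsum m) {p \<in> polydisc. xcoord p \<noteq> 0}"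
  unfolding holo_mat_on_def
proof (intro allI)
  fix i j :: 'a
  let ?U = "{p \<in> polydisc :: 'a pt set. xcoord p \<noteq> 0}"
  have eq: "?U = polydisc \<inter> {p. xcoord p \<noteq> 0}"
    by blast
  have "open ?U"
    unfolding eq by (rule open_Int[OF open_polydisc open_xcoord_nonzero])
  then show "holo_on (\<lambda>p. Vsum m p $ i $ j) ?U"
  proof (rule holo_on_cong)
    show "Vsum m p $ i $ j = inverse (xcoord p) * Vm1 m $ i $ j
        + (\<Sum>n. regular_term m n p) $ i $ j" if "p \<in> ?U" for p
      using that by (simp add: Vsum_decomp cscale_def)
    show "holo_on (\<lambda>p. inverse (xcoord p) * Vm1 m $ i $ j
        + (\<Sum>n. regular_term m n p) $ i $ j) ?U"
      by (intro holo_on_add holo_on_mult holo_on_inverse holo_on_xcoord holo_on_const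
          holo_on_subset[OF holo_on_regular_part]) auto
  qed
qed

lemma mero_mat_on_Vsum: "mero_mat_on (Vsum m) polydisc"
  unfolding mero_mat_on_def mero_on_def
proof (intro allI ballI)
  fix i j :: 'a and p :: "'a pt" assume p: "p \<in> polydisc"
  let ?g = "\<lambda>p. Vm1 m $ i $ j + xcoord p * (\<Sum>n. regular_term m n p) $ i $ j"
  have "holo_on ?g polydisc"
    by (intro holo_on_add holo_on_mult holo_on_xcoord holo_on_const holo_on_regular_part)
  moreover have "Vsum m q $ i $ j = ?g q / xcoord q" if "q \<in> polydisc" "xcoord q \<noteq> 0" for q
    using that by (simp add: Vsum_decomp cscale_def field_simps)
  ultimately show "\<exists>W g h. open W \<and> p \<in> W \<and> W \<subseteq> polydisc \<and> holo_on g W \<and> holo_on h W \<and>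
      (\<forall>W'. open W' \<and> W' \<noteq> {} \<and> W' \<subseteq> W \<longrightarrow> (\<exists>q\<in>W'. h q \<noteq> 0)) \<and>
      (\<forall>q\<in>W. h q \<noteq> 0 \<longrightarrow> Vsum m q $ i $ j = g q / h q)"
    using p open_polydisc holo_on_xcoord xcoord_nonzero_in_open
    by - (rule exI[of _ polydisc], rule exI[of _ ?g], rule exI[of _ xcoord], blast)
qed

(* closure (K m) contains, besides K m, the points with x = 0, where the pole is located. *)
theorem corollary1:
  fixes m :: nat
  assumes "m \<le> CARD('n::{finite,linorder})"
  shows "\<exists>U :: 'n pt set. open U \<and> closure (K m) \<subseteq> U \<and>
    (\<forall>p\<in>U. xcoord p \<noteq> 0 \<longrightarrow> summable (Vterm m p)) \<and>
    mero_mat_on (Vsum m) U \<and>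
    holo_mat_on (Vsum m) {p \<in> U. xcoord p \<noteq> 0}"
  by (rule exI[of _ polydisc])
    (intro conjI ballI impI open_polydisc closure_K_subset summable_Vterm mero_mat_on_Vsum
      holo_mat_on_Vsum)

end
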